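(* Let $(S,\mathcal{C})$ be a connectoid and let $U\subseteq S$ be a set that is contained in a normal tree of $(S,\mathcal{C})$. Then for every connected subconnectoid $(S',\mathcal{C}')$ of $(S,\mathcal{C})$ there is a normal tree of $(S',\mathcal{C}')$ that contains $U\cap S'$.
   Context: Connectoids: let $S$ be a set and let $\mathcal{F}$ be a set of finite subsets of $S$ such that (i) $F\cup F'\in\mathcal{F}$ whenever $F,F'\in\mathcal{F}$ and $F\cap F'\neq\emptyset$, and (ii) $\emptyset\in\mathcal{F}$ and $\{s\}\in\mathcal{F}$ for every $s\in S$. A subset $C\subseteq S$ is connected if for every $x,y\in C$ there is $F\in\mathcal{F}$ with $F\subseteq C$ and $x,y\in F$. The pair $(S,\mathcal{C})$, where $\mathcal{C}$ is the set of connected subsets of $S$, is the connectoid induced by $\mathcal{F}$; a connectoid is any pair arising in this way. It is connected if $S\in\mathcal{C}$. A connectoid $(S',\mathcal{C}')$ is a subconnectoid of $(S,\mathcal{C})$ if $S'\subseteq S$ and $\mathcal{C}'\subseteq\mathcal{C}$. Necklaces: with $\mathbb{N}=\{1,2,3,\dots\}$, a connected set $N$ is a necklace if there is a family $(H_n)_{n\in\mathbb{N}}$ of finite connected sets with $N=\bigcup_{n}H_n$ such that, for all $i,j\in\mathbb{N}$, $H_i\cap H_j\neq\emptyset$ if and only if $|i-j|\leq 1$. Normal trees: $\leq_T$ denotes the tree-order of a rooted tree $T$. A weak normal tree of $(S,\mathcal{C})$ is a rooted undirected tree $T$ with $V(T)\subseteq S$ such that (a) for every $C\in\mathcal{C}$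 and every two $\leq_T$-incomparable $u,v\in C\cap V(T)$ there is $w\in C$ with $w\leq_T u,v$, and (b) for every $u\leq_T v$ in $V(T)$ there is $C\in\mathcal{C}$ with $u,v\in C$ that contains no $w<_T u$. A weak normal tree $T$ is a normal tree if moreover for every ray $R$ in $T$ starting at the root there is a necklace containing all but finitely many elements of $V(R)$. A tree contains a set $U$ if $U\subseteq V(T)$. *)

theory Defs
  imports Main
begin

section \<open>Connectoids\<close>

definition connectoid_base :: "'a set \<Rightarrow> 'a set set \<Rightarrow> bool" where
  "connectoid_base S \<F> \<longleftrightarrow>
     (\<forall>F\<in>\<F>. finite F \<and> F \<subseteq> S) \<and>
     (\<forall>F\<in>\<F>. \<forall>F'\<in>\<F>. F \<inter> F' \<noteq> {} \<longrightarrow> F \<union> F' \<in> \<F>) \<and>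
     {} \<in> \<F> \<and> (\<forall>s\<in>S. {s} \<in> \<F>)"

definition connected_sets :: "'a set \<Rightarrow> 'a set set \<Rightarrow> 'a set set" where
  "connected_sets S \<F> =
     {C. C \<subseteq> S \<and> (\<forall>x\<in>C. \<forall>y\<in>C. \<exists>F\<in>\<F>. F \<subseteq> C \<and> x \<in> F \<and> y \<in> F)}"

definition connectoid :: "'a set \<Rightarrow> 'a set set \<Rightarrow> bool" where
  "connectoid S \<C> \<longleftrightarrow> (\<exists>\<F>. connectoid_base S \<F> \<and> \<C> = connected_sets S \<F>)"

definition connected_connectoid :: "'a set \<Rightarrow> 'a set set \<Rightarrow> bool" where
  "connected_connectoid S \<C> \<longleftrightarrow> connectoid S \<C> \<and> S \<in> \<C>"

definition subconnectoid :: "'a set \<Rightarrow> 'a set set \<Rightarrow> 'a set \<Rightarrow> 'a set set \<Rightarrow> bool" where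
  "subconnectoid S' \<C>' S \<C> \<longleftrightarrow>
     connectoid S' \<C>' \<and> connectoid S \<C> \<and> S' \<subseteq> S \<and> \<C>' \<subseteq> \<C>"

(* The sets H n are indexed from 0 instead of 1; the condition on indices only involves
   their distance. *)
definition necklace :: "'a set set \<Rightarrow> 'a set \<Rightarrow> bool" where
  "necklace \<C> N \<longleftrightarrow> N \<in> \<C> \<and>
     (\<exists>H :: nat \<Rightarrow> 'a set. (\<forall>n. finite (H n) \<and> H n \<in> \<C>) \<and> N = (\<Union>n. H n) \<and>
        (\<forall>i j. H i \<inter> H j \<noteq> {} \<longleftrightarrow> \<bar>int i - int j\<bar> \<le> 1))"


section \<open>Rooted undirected trees\<close>

(* Possibly infinite simple graphs with a distinguished vertex; an edge is a two-element
   set of vertices. *)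
record 'a rooted_graph =
  verts :: "'a set"
  edges :: "'a set set"
  root :: 'a

definition simple_rooted_graph :: "'a rooted_graph \<Rightarrow> bool" where
  "simple_rooted_graph T \<longleftrightarrow>
     (\<forall>e\<in>edges T. e \<subseteq> verts T \<and> card e = 2) \<and> root T \<in> verts T"

definition path_in :: "'a rooted_graph \<Rightarrow> 'a list \<Rightarrow> bool" where
  "path_in T p \<longleftrightarrow> p \<noteq> [] \<and> distinct p \<and> set p \<subseteq> verts T \<and>
     successively (\<lambda>x y. {x, y} \<in> edges T) p"

definition path_from_to :: "'a rooted_graph \<Rightarrow> 'a \<Rightarrow> 'a \<Rightarrow> 'a list \<Rightarrow> bool" where
  "path_from_to T u v p \<longleftrightarrow> path_in T p \<and> hd p = u \<and> last p = v"

definition cycle_in :: "'a rooted_graph \<Rightarrow> 'a list \<Rightarrow> bool" where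
  "cycle_in T p \<longleftrightarrow> path_in T p \<and> 3 \<le> length p \<and> {last p, hd p} \<in> edges T"

(* In particular a rooted tree has at least one vertex, its root. *)
definition rooted_tree :: "'a rooted_graph \<Rightarrow> bool" where
  "rooted_tree T \<longleftrightarrow> simple_rooted_graph T \<and>
     (\<forall>u\<in>verts T. \<forall>v\<in>verts T. \<exists>p. path_from_to T u v p) \<and>
     (\<nexists>p. cycle_in T p)"

(* u lies on the (unique) path in T from the root to v; both are then vertices of T. *)
definition tree_le :: "'a rooted_graph \<Rightarrow> 'a \<Rightarrow> 'a \<Rightarrow> bool" where
  "tree_le T u v \<longleftrightarrow> (\<exists>p. path_from_to T (root T) v p \<and> u \<in> set p)"

definition tree_less :: "'a rooted_graph \<Rightarrow> 'a \<Rightarrow> 'a \<Rightarrow> bool" where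
  "tree_less T u v \<longleftrightarrow> tree_le T u v \<and> u \<noteq> v"

definition root_ray :: "'a rooted_graph \<Rightarrow> (nat \<Rightarrow> 'a) \<Rightarrow> bool" where
  "root_ray T R \<longleftrightarrow> R 0 = root T \<and> inj R \<and> (\<forall>n. {R n, R (Suc n)} \<in> edges T)"


section \<open>Normal trees\<close>

definition weak_normal_tree :: "'a set \<Rightarrow> 'a set set \<Rightarrow> 'a rooted_graph \<Rightarrow> bool" where
  "weak_normal_tree S \<C> T \<longleftrightarrow> rooted_tree T \<and> verts T \<subseteq> S \<and>
     (\<forall>C\<in>\<C>. \<forall>u\<in>C \<inter> verts T. \<forall>v\<in>C \<inter> verts T.
        \<not> tree_le T u v \<and> \<not> tree_le T v u \<longrightarrow>
        (\<exists>w\<in>C. tree_le T w u \<and> tree_le T w v)) \<and>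
     (\<forall>u\<in>verts T. \<forall>v\<in>verts T. tree_le T u v \<longrightarrow>
        (\<exists>C\<in>\<C>. u \<in> C \<and> v \<in> C \<and> \<not> (\<exists>w\<in>C. tree_less T w u)))"

definition normal_tree :: "'a set \<Rightarrow> 'a set set \<Rightarrow> 'a rooted_graph \<Rightarrow> bool" where
  "normal_tree S \<C> T \<longleftrightarrow> weak_normal_tree S \<C> T \<and>
     (\<forall>R. root_ray T R \<longrightarrow> (\<exists>N. necklace \<C> N \<and> finite (range R - N)))"

end

(* Choose a vertex in a connected set, delete it, treat each component of the rest in the same way,
   and make the vertices chosen there the children of the first one: this always yields a weak
   normal tree. Starting from S' and suitably ordering the choices, one can moreover ensure that
   every ray has a necklace and that each infinite run of choices uses a prescribed element t D in
   infinitely many of the components D it passes through. Let T be a normal tree containing U and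
   let t D be the T-least element of D \<inter> V(T). A vertex v of T in S' is then eventually chosen:
   otherwise infinitely many different t D would lie below v in T. *)
theory Submission
  imports Defs
begin

section \<open>Rooted trees\<close>

lemma successively_edges_rev:
  "successively (\<lambda>x y. {x, y} \<in> E) (rev p) \<longleftrightarrow> successively (\<lambda>x y. {x, y} \<in> E) p"
  by (simp add: insert_commute)

lemma path_in_append1: "path_in T (p @ q) \<Longrightarrow> p \<noteq> [] \<Longrightarrow> path_in T p"
  unfolding path_in_def by (auto simp: successively_append_iff)

lemma path_in_append2: "path_in T (p @ q) \<Longrightarrow> q \<noteq> [] \<Longrightarrow> path_in T q"
  unfolding path_in_def by (auto simp: successively_append_iff)

text \<open>Common initial vertices are cancelled by induction. At the first divergence the two
  paths must meet again, since they end alike, and the two segments in between close up to a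
  cycle.\<close>

lemma acyclic_path_unique:
  assumes "\<nexists>c. cycle_in T c"
  shows "path_in T p \<Longrightarrow> path_in T q \<Longrightarrow> hd p = hd q \<Longrightarrow> last p = last q \<Longrightarrow> p = q"
proof (induction p arbitrary: q)
  case Nil
  then show ?case by (simp add: path_in_def)
next
  case (Cons u p)
  obtain q' where q: "q = u # q'"
    using Cons.prems by (cases q) (auto simp: path_in_def)
  have nu: "u \<notin> set p" "u \<notin> set q'"
    using Cons.prems q by (auto simp: path_in_def)
  show ?case
  proof (cases "p = [] \<or> q' = []")
    case True
    then show ?thesis
      using nu Cons.prems(4) q
      by (cases "p = []"; cases "q' = []") (auto dest: last_in_set)
  next
    case False
    have pp: "path_in T p" "path_in T q'"
      using Cons.prems(1,2) False q path_in_append2[of T "[u]"] by auto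
    have ll: "last p = last q'" using Cons.prems(4) q False by simp
    show ?thesis
    proof (cases "hd p = hd q'")
      case True
      then show ?thesis using Cons.IH[OF pp True ll] q by simp
    next
      case ne: False
      have "\<exists>x\<in>set p. x \<in> set q'" using ll False last_in_set by metis
      \<comment> \<open>\<open>w\<close> is the first vertex of the tail \<open>p\<close> that also
        lies on \<open>q'\<close>, so the two segments from \<open>u\<close> to \<open>w\<close>
        share only their ends.\<close>
      then obtain p1 w p2 where p: "p = p1 @ w # p2" "w \<in> set q'" "\<forall>x\<in>set p1. x \<notin> set q'"
        using split_list_first_prop[of p "\<lambda>x. x \<in> set q'"] by blast
      obtain q1 q2 where q1: "q' = q1 @ w # q2" using p(2) split_list by metis
      \<comment> \<open>As the tails start differently, \<open>w\<close> is not the next vertex on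
        both. The closed walk thus has a third vertex besides \<open>u\<close> and \<open>w\<close>,
        as \<open>cycle_in\<close> demands.\<close>
      have "p1 \<noteq> [] \<or> q1 \<noteq> []" using ne p(1) q1 by (cases p1; cases q1) auto
      then have len: "3 \<le> length (u # p1 @ w # rev q1)" by (cases p1; cases q1) auto
      have a: "successively (\<lambda>x y. {x, y} \<in> edges T) (u # p1 @ [w])"
        and b: "successively (\<lambda>x y. {x, y} \<in> edges T) (u # q1 @ [w])"
        and d: "distinct (u # p1 @ [w])" "distinct (u # q1 @ [w])"
        and s: "set (u # p1 @ [w]) \<subseteq> verts T" "set (u # q1 @ [w]) \<subseteq> verts T"
        using path_in_append1[of T "u # p1 @ [w]" p2] path_in_append1[of T "u # q1 @ [w]" q2]
          Cons.prems(1,2) p(1) q q1 by (simp_all add: path_in_def)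
      have b': "successively (\<lambda>x y. {x, y} \<in> edges T) (w # rev q1)"
      proof -
        have "successively (\<lambda>x y. {x, y} \<in> edges T) (q1 @ [w])"
          using b by (cases "q1 @ [w]") auto
        then have "successively (\<lambda>x y. {x, y} \<in> edges T) (rev (q1 @ [w]))"
          by (subst successively_edges_rev)
        then show ?thesis by simp
      qed
      have "successively (\<lambda>x y. {x, y} \<in> edges T) ((u # p1) @ (w # rev q1))"
        using a b' successively_append_iff[of _ "u # p1" "[w]"]
          successively_append_iff[of _ "u # p1" "w # rev q1"] by auto
      moreover have "distinct ((u # p1) @ (w # rev q1))"
        using d p(3) q1 nu p by auto
      moreover have "{last (u # p1 @ w # rev q1), u} \<in> edges T"
      proof (cases q1)
        case Nil
        then show ?thesis using b by (simp add: insert_commute)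
      next
        case (Cons c cs)
        then show ?thesis using b by (simp add: insert_commute)
      qed
      ultimately have "cycle_in T (u # p1 @ w # rev q1)"
        using len s unfolding cycle_in_def path_in_def by auto
      then show ?thesis using assms by blast
    qed
  qed
qed

lemma rooted_tree_path_unique:
  assumes "rooted_tree T" "path_from_to T u v p" "path_from_to T u v q"
  shows "p = q"
  using assms acyclic_path_unique[of T p q] unfolding rooted_tree_def path_from_to_def by auto

section \<open>The tree-order: finite down-sets, depth and least elements\<close>

lemma finite_tree_le:
  assumes "rooted_tree T"
  shows "finite {u. tree_le T u v}"
proof (cases "\<exists>p. path_from_to T (root T) v p")
  case True
  then obtain p where "path_from_to T (root T) v p" by blast
  then have "{u. tree_le T u v} \<subseteq> set p"
    using rooted_tree_path_unique[OF assms] unfolding tree_le_def by blast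
  then show ?thesis using finite_subset by blast
qed (simp add: tree_le_def)

definition tree_depth :: "'a rooted_graph \<Rightarrow> 'a \<Rightarrow> nat" where
  "tree_depth T v = length (THE p. path_from_to T (root T) v p)"

lemma tree_depth_less:
  assumes "rooted_tree T" "tree_less T u v"
  shows "tree_depth T u < tree_depth T v"
proof -
  have depth: "tree_depth T w = length p" if "path_from_to T (root T) w p" for w p
    unfolding tree_depth_def using that rooted_tree_path_unique[OF assms(1)]
    by (metis the_equality)
  obtain p where p: "path_from_to T (root T) v p" "u \<in> set p" and ne: "u \<noteq> v"
    using assms(2) unfolding tree_less_def tree_le_def by blast
  then obtain p1 p2 where p12: "p = p1 @ u # p2" using split_list by metis
  have "p2 \<noteq> []" using p(1) p12 ne by (auto simp: path_from_to_def)
  have "path_from_to T (root T) u (p1 @ [u])"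
    using p(1) p12 path_in_append1[of T "p1 @ [u]" p2] unfolding path_from_to_def
    by (cases p1) auto
  then show ?thesis using depth p(1) p12 \<open>p2 \<noteq> []\<close> by fastforce
qed

lemma tree_le_verts: "tree_le T u v \<Longrightarrow> u \<in> verts T"
  unfolding tree_le_def path_from_to_def path_in_def by blast

text \<open>Take \<open>u\<close> of least depth in \<open>D\<close>; then \<open>u\<close> is the
  only element of \<open>D\<close> below \<open>u\<close>. If \<open>v\<close> in \<open>D\<close>
  were not above \<open>u\<close>, the two would be incomparable, and condition (a) would give a
  common lower bound in \<open>D\<close>, which can only be \<open>u\<close> itself.\<close>

lemma weak_normal_tree_minimum:
  assumes "weak_normal_tree S \<C> T" "D \<in> \<C>" "D \<inter> verts T \<noteq> {}"
  shows "\<exists>u \<in> D \<inter> verts T. \<forall>v \<in> D \<inter> verts T. tree_le T u v"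
proof -
  obtain u where u: "u \<in> D \<inter> verts T"
    and min: "\<And>v. v \<in> D \<inter> verts T \<Longrightarrow> tree_depth T u \<le> tree_depth T v"
    using exists_least_iff[of "\<lambda>n. \<exists>u \<in> D \<inter> verts T. tree_depth T u = n"] assms(3)
    by (metis equals0I not_less)
  have rt: "rooted_tree T" using assms(1) by (simp add: weak_normal_tree_def)
  have below: "w = u" if "w \<in> D" "tree_le T w u" for w
    using tree_depth_less[OF rt, of w u] min[of w] that tree_le_verts
    unfolding tree_less_def by (metis IntI not_less)
  have "tree_le T u v" if v: "v \<in> D \<inter> verts T" for v
  proof (rule ccontr)
    assume "\<not> tree_le T u v"
    then have "\<exists>w\<in>D. tree_le T w u \<and> tree_le T w v"
      using assms(1,2) u v below[of v] unfolding weak_normal_tree_def by blast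
    then show False using below \<open>\<not> tree_le T u v\<close> by blast
  qed
  then show ?thesis using u by blast
qed

section \<open>Building a rooted tree from levels and ancestors\<close>

lemma path_from_to_rtranclp:
  assumes "simple_rooted_graph T" "(\<lambda>x y. {x, y} \<in> edges T)\<^sup>*\<^sup>* u v" "u \<in> verts T"
  shows "\<exists>p. path_from_to T u v p"
  using assms(2)
proof induction
  case base
  have "path_from_to T u u [u]" using assms(3) by (simp add: path_from_to_def path_in_def)
  then show ?case by blast
next
  case (step y z)
  then obtain p where p: "path_from_to T u y p" by blast
  have z: "z \<in> verts T" using step(2) assms(1) unfolding simple_rooted_graph_def by blast
  show ?case
  proof (cases "z \<in> set p")
    case True
    then obtain p1 p2 where p12: "p = p1 @ z # p2" using split_list by metis
    have "path_from_to T u z (p1 @ [z])"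
      using p p12 path_in_append1[of T "p1 @ [z]" p2] unfolding path_from_to_def
      by (cases p1) auto
    then show ?thesis by blast
  next
    case False
    have "path_from_to T u z (p @ [z])"
      using p z False step(2) unfolding path_from_to_def path_in_def
      by (auto simp: successively_append_iff)
    then show ?thesis by blast
  qed
qed

text \<open>An order-theoretic description of a rooted tree: \<open>dep\<close> is the level of a
  vertex and \<open>anc m x\<close> its ancestor at level \<open>m\<close>. The axioms leave
  \<open>anc m x\<close> free for \<open>m\<close> beyond \<open>dep x\<close>, which permits
  meaningless values there.\<close>

locale levelled =
  fixes V :: "'a set" and dep :: "'a \<Rightarrow> nat" and anc :: "nat \<Rightarrow> 'a \<Rightarrow> 'a" and r :: 'a
  assumes root_in: "r \<in> V"
    and anc_0: "x \<in> V \<Longrightarrow> anc 0 x = r"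
    and anc_in: "x \<in> V \<Longrightarrow> m \<le> dep x \<Longrightarrow> anc m x \<in> V"
    and dep_anc: "x \<in> V \<Longrightarrow> m \<le> dep x \<Longrightarrow> dep (anc m x) = m"
    and anc_dep: "x \<in> V \<Longrightarrow> anc (dep x) x = x"
    and anc_anc: "x \<in> V \<Longrightarrow> k \<le> m \<Longrightarrow> m \<le> dep x \<Longrightarrow> anc k (anc m x) = anc k x"
begin

definition tree :: "'a rooted_graph" where
  "tree = \<lparr>verts = V, edges = {{anc n x, x} | n x. x \<in> V \<and> dep x = Suc n}, root = r\<rparr>"

lemma verts_tree [simp]: "verts tree = V" and root_tree [simp]: "root tree = r"
  by (simp_all add: tree_def)

lemma edges_tree_iff:
  "{x, y} \<in> edges tree \<longleftrightarrow>
     y \<in> V \<and> (\<exists>n. dep y = Suc n \<and> x = anc n y) \<or> x \<in> V \<and> (\<exists>n. dep x = Suc n \<and> y = anc n x)"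
  by (auto simp: tree_def doubleton_eq_iff)

lemma dep_root: "dep r = 0"
  using dep_anc[OF root_in, of 0] anc_0[OF root_in] by simp

lemma simple_tree: "simple_rooted_graph tree"
proof -
  have "e \<subseteq> V \<and> card e = 2" if "e \<in> edges tree" for e
  proof -
    obtain n x where e: "e = {anc n x, x}" "x \<in> V" "dep x = Suc n"
      using \<open>e \<in> edges tree\<close> by (auto simp: tree_def)
    then have "anc n x \<in> V" "anc n x \<noteq> x" using anc_in[of x n] dep_anc[of x n] by auto
    then show ?thesis using e by auto
  qed
  then show ?thesis using root_in by (simp add: simple_rooted_graph_def)
qed

text \<open>A vertex has a single neighbour of lower level, its parent. A sequence from the root
  that does not repeat has already used that parent, so each step goes one level down the tree. The
  bound \<open>L\<close> makes this apply both to finite paths and to initial segments of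
  rays.\<close>

lemma root_seq:
  assumes "f 0 = r" "inj_on f {..<L}" "\<And>n. Suc n < L \<Longrightarrow> {f n, f (Suc n)} \<in> edges tree"
  shows "n < L \<Longrightarrow> f n \<in> V \<and> dep (f n) = n \<and> (\<forall>m\<le>n. anc m (f n) = f m)"
proof (induction n)
  case 0
  then show ?case using assms(1) root_in dep_root anc_0 by simp
next
  case (Suc n)
  then have IH: "f n \<in> V" "dep (f n) = n" "\<forall>m\<le>n. anc m (f n) = f m" by auto
  from assms(3)[OF Suc.prems] consider
    k where "f (Suc n) \<in> V" "dep (f (Suc n)) = Suc k" "f n = anc k (f (Suc n))" |
    k where "dep (f n) = Suc k" "f (Suc n) = anc k (f n)"
    unfolding edges_tree_iff by blast
  then show ?case
  proof cases
    case 1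
    then have k: "k = n" using dep_anc[of "f (Suc n)" k] IH(2) by simp
    have "anc m (f (Suc n)) = f m" if "m \<le> Suc n" for m
    proof (cases "m = Suc n")
      case True
      then show ?thesis using 1 k anc_dep by metis
    next
      case False
      then show ?thesis
        using 1 k IH(3) anc_anc[of "f (Suc n)" m n] that by simp
    qed
    then show ?thesis using 1 k by simp
  next
    case 2
    then have "f (Suc n) = f k" "k < Suc n" using IH by auto
    then show ?thesis using inj_onD[OF assms(2), of "Suc n" k] Suc.prems by simp
  qed
qed

text \<open>At a vertex of maximal level on a cycle, both neighbours would have to be its unique
  parent.\<close>

lemma no_cycle: "\<not> cycle_in tree p"
proof
  assume "cycle_in tree p"
  then have p: "distinct p" "set p \<subseteq> V" "successively (\<lambda>x y. {x, y} \<in> edges tree) p"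
    and len: "3 \<le> length p" and cl: "{last p, hd p} \<in> edges tree"
    by (auto simp: cycle_in_def path_in_def)
  define L where "L = length p"
  \<comment> \<open>Cyclic indexing treats the closing edge like all others; the predecessor of
    position \<open>i\<close> is then \<open>i + (L - 1)\<close>.\<close>
  define f where "f i = p ! (i mod L)" for i
  have L: "3 \<le> L" using len by (simp add: L_def)
  have fV: "f i \<in> V" for i
    unfolding f_def using L by (intro subsetD[OF p(2)] nth_mem) (simp flip: L_def)
  have edge: "{f i, f (Suc i)} \<in> edges tree" for i
  proof (cases "Suc (i mod L) = L")
    case True
    then have "i mod L = L - 1" "Suc i mod L = 0" using L by (auto simp: mod_Suc)
    then have "f i = last p" "f (Suc i) = hd p"
      using L by (cases p; simp add: f_def L_def last_conv_nth)+
    then show ?thesis using cl by simp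
  next
    case False
    moreover have "i mod L < L" using L by simp
    ultimately have "Suc i mod L = Suc (i mod L)" "Suc (i mod L) < length p"
      by (auto simp: mod_Suc simp flip: L_def)
    then show ?thesis using p(3) by (simp add: successively_conv_nth f_def)
  qed
  obtain i where i: "\<And>j. dep (f j) \<le> dep (f i)"
  proof -
    have fin: "finite ((\<lambda>j. dep (f j)) ` UNIV)"
    proof (rule finite_subset)
      show "(\<lambda>j. dep (f j)) ` UNIV \<subseteq> dep ` set p"
        using L by (auto simp: f_def simp flip: L_def intro!: imageI nth_mem)
    qed simp
    have "Max ((\<lambda>j. dep (f j)) ` UNIV) \<in> (\<lambda>j. dep (f j)) ` UNIV"
      using fin by (intro Max_in) auto
    then obtain i where "dep (f i) = Max ((\<lambda>j. dep (f j)) ` UNIV)" by auto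
    then have "dep (f j) \<le> dep (f i)" for j using Max_ge[OF fin] by auto
    then show ?thesis using that by blast
  qed
  have up: "y = anc (dep (f i) - 1) (f i)"
    if "{f i, y} \<in> edges tree" "dep y \<le> dep (f i)" for y
    using that dep_anc[of y] unfolding edges_tree_iff by fastforce
  have "f (i + (L - 1)) = f (Suc i)"
  proof -
    have "f (Suc (i + (L - 1))) = f i" using L by (simp add: f_def)
    then have "{f i, f (i + (L - 1))} \<in> edges tree"
      using edge[of "i + (L - 1)"] by (simp add: insert_commute)
    then show ?thesis using up[of "f (i + (L - 1))"] up[of "f (Suc i)"] edge[of i] i by metis
  qed
  then have "(i + (L - 1)) mod L = Suc i mod L"
    using p(1) L nth_eq_iff_index_eq[of p] by (simp add: f_def flip: L_def)
  \<comment> \<open>The two neighbours are \<open>L - 2\<close> positions apart, and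
    \<open>0 < L - 2 < L\<close>, so they cannot coincide modulo \<open>L\<close>.\<close>
  then have "L dvd (i + (L - 1)) - Suc i" by (intro mod_eq_dvd_iff_nat[THEN iffD1]) (use L in auto)
  moreover have "(i + (L - 1)) - Suc i = L - 2" by simp
  ultimately have "L \<le> L - 2" using L by (intro dvd_imp_le) auto
  then show False using L by simp
qed

lemma reach_root: "x \<in> V \<Longrightarrow> (\<lambda>x y. {x, y} \<in> edges tree)\<^sup>*\<^sup>* r x"
proof (induction "dep x" arbitrary: x)
  case 0
  then show ?case using anc_dep[of x] anc_0[of x] by simp
next
  case (Suc n)
  have "{anc n x, x} \<in> edges tree" using Suc unfolding edges_tree_iff by metis
  moreover have "(\<lambda>x y. {x, y} \<in> edges tree)\<^sup>*\<^sup>* r (anc n x)"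
    using Suc anc_in[of x n] dep_anc[of x n] by simp
  ultimately show ?case by (rule rtranclp.rtrancl_into_rtrancl[rotated])
qed

lemma rooted_tree: "rooted_tree tree"
proof -
  have sym: "symp (\<lambda>x y. {x, y} \<in> edges tree)" by (simp add: symp_def insert_commute)
  have "\<exists>p. path_from_to tree u v p" if "u \<in> V" "v \<in> V" for u v
  proof -
    have "(\<lambda>x y. {x, y} \<in> edges tree)\<^sup>*\<^sup>* u r"
      using reach_root[OF \<open>u \<in> V\<close>] sympD[OF symp_rtranclp[OF sym]] by blast
    then have "(\<lambda>x y. {x, y} \<in> edges tree)\<^sup>*\<^sup>* u v"
      using reach_root[OF \<open>v \<in> V\<close>] by (rule rtranclp_trans)
    then show ?thesis using path_from_to_rtranclp[OF simple_tree] that by simp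
  qed
  then show ?thesis using simple_tree no_cycle by (simp add: rooted_tree_def)
qed

text \<open>By \<open>root_seq\<close>, the vertex at position \<open>m\<close> of the root path to
  \<open>v\<close> is \<open>anc m v\<close>.\<close>

lemma tree_le_iff:
  assumes "v \<in> V"
  shows "tree_le tree u v \<longleftrightarrow> (\<exists>m\<le>dep v. u = anc m v)"
proof -
  obtain p where p: "path_from_to tree r v p"
    using rooted_tree assms root_in unfolding rooted_tree_def verts_tree by blast
  have seq: "p ! n \<in> V \<and> dep (p ! n) = n \<and> (\<forall>m\<le>n. anc m (p ! n) = p ! m)" if "n < length p" for n
  proof (rule root_seq[of "\<lambda>n. p ! n" "length p"])
    show "p ! 0 = r" using p by (auto simp: path_from_to_def path_in_def hd_conv_nth)
    show "inj_on ((!) p) {..<length p}"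
      using p by (auto simp: path_from_to_def path_in_def inj_on_nth)
    show "{p ! n, p ! Suc n} \<in> edges tree" if "Suc n < length p" for n
      using p that by (auto simp: path_from_to_def path_in_def successively_conv_nth)
  qed (rule that)
  have v: "v = p ! (length p - 1)" "0 < length p"
    using p by (auto simp: path_from_to_def path_in_def last_conv_nth)
  then have dv: "dep v = length p - 1" and anc: "\<And>m. m \<le> dep v \<Longrightarrow> anc m v = p ! m"
    using seq[of "length p - 1"] by auto
  have "set p = {anc m v | m. m \<le> dep v}"
  proof -
    have "i < length p \<longleftrightarrow> i \<le> dep v" for i using dv v(2) by linarith
    then show ?thesis using anc unfolding set_conv_nth by metis
  qed
  moreover have "tree_le tree u v \<longleftrightarrow> u \<in> set p"
    using p rooted_tree_path_unique[OF rooted_tree] unfolding tree_le_def root_tree by metis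
  ultimately show ?thesis by blast
qed

lemma root_rayD:
  assumes "root_ray tree R"
  shows "R n \<in> V" "dep (R n) = n" "m \<le> n \<Longrightarrow> anc m (R n) = R m"
proof -
  have "inj_on R {..<Suc n}" using assms unfolding root_ray_def by (metis inj_on_subset subset_UNIV)
  then have "R n \<in> V \<and> dep (R n) = n \<and> (\<forall>m\<le>n. anc m (R n) = R m)"
    using assms unfolding root_ray_def by (intro root_seq[of R "Suc n"]) auto
  then show "R n \<in> V" "dep (R n) = n" "m \<le> n \<Longrightarrow> anc m (R n) = R m" by auto
qed

end


section \<open>Connectoids\<close>

lemma base_connected: "connectoid_base S \<F> \<Longrightarrow> F \<in> \<F> \<Longrightarrow> F \<in> connected_sets S \<F>"
  unfolding connectoid_base_def connected_sets_def by auto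

lemma connectoid_subset: "connectoid S \<C> \<Longrightarrow> C \<in> \<C> \<Longrightarrow> C \<subseteq> S"
  unfolding connectoid_def connected_sets_def by blast

lemma connectoid_empty: "connectoid S \<C> \<Longrightarrow> {} \<in> \<C>"
  unfolding connectoid_def connected_sets_def by blast

lemma connectoid_singleton: "connectoid S \<C> \<Longrightarrow> x \<in> S \<Longrightarrow> {x} \<in> \<C>"
  unfolding connectoid_def connected_sets_def connectoid_base_def by blast

text \<open>Any two points are joined through \<open>z\<close>: the two base sets linking them to
  \<open>z\<close> intersect, so their union is again a base set.\<close>

lemma connectoid_Union:
  assumes "connectoid S \<C>" "\<A> \<subseteq> \<C>" "\<And>C. C \<in> \<A> \<Longrightarrow> z \<in> C"
  shows "\<Union>\<A> \<in> \<C>"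
proof -
  obtain \<F> where base: "connectoid_base S \<F>" and \<C>: "\<C> = connected_sets S \<F>"
    using assms(1) unfolding connectoid_def by blast
  have "\<exists>F\<in>\<F>. F \<subseteq> \<Union>\<A> \<and> x \<in> F \<and> y \<in> F" if xy: "x \<in> \<Union>\<A>" "y \<in> \<Union>\<A>" for x y
  proof -
    obtain C D where CD: "C \<in> \<A>" "x \<in> C" "D \<in> \<A>" "y \<in> D" using xy by blast
    obtain F where F: "F \<in> \<F>" "F \<subseteq> C" "x \<in> F" "z \<in> F"
      using CD assms(2,3) unfolding \<C> connected_sets_def by blast
    obtain F' where F': "F' \<in> \<F>" "F' \<subseteq> D" "y \<in> F'" "z \<in> F'"
      using CD assms(2,3) unfolding \<C> connected_sets_def by blast
    have "F \<union> F' \<in> \<F>" using base F F' unfolding connectoid_base_def by blast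
    moreover have "F \<union> F' \<subseteq> \<Union>\<A>" using F(2) F'(2) CD(1,3) by blast
    ultimately show ?thesis using F(3) F'(3) by blast
  qed
  moreover have "\<Union>\<A> \<subseteq> S" using assms(2) unfolding \<C> connected_sets_def by blast
  ultimately show ?thesis unfolding \<C> connected_sets_def by blast
qed

lemma connectoid_Un:
  assumes "connectoid S \<C>" "C \<in> \<C>" "D \<in> \<C>" "C \<inter> D \<noteq> {}"
  shows "C \<union> D \<in> \<C>"
proof -
  obtain z where "z \<in> C" "z \<in> D" using assms(4) by blast
  then show ?thesis using connectoid_Union[OF assms(1), of "{C, D}" z] assms(2,3) by auto
qed

lemma connectoid_UN_chain:
  assumes "connectoid S \<C>" "\<And>n. H n \<in> \<C>" "\<And>n. H n \<inter> H (Suc n) \<noteq> {}"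
  shows "(\<Union>n. H n) \<in> \<C>"
proof -
  have K: "(\<Union>i\<le>n. H i) \<in> \<C>" for n
  proof (induction n)
    case (Suc n)
    have "(\<Union>i\<le>n. H i) \<inter> H (Suc n) \<noteq> {}" using assms(3)[of n] by blast
    then show ?case
      using connectoid_Un[OF assms(1) Suc assms(2)[of "Suc n"]] by (simp add: atMost_Suc Un_commute)
  qed (use assms(2) in simp)
  obtain z where z: "z \<in> H 0" using assms(3)[of 0] by blast
  have "(\<Union>n. H n) = \<Union> (range (\<lambda>n. \<Union>i\<le>n. H i))" by auto
  also have "\<dots> \<in> \<C>" using K z by (intro connectoid_Union[OF assms(1)]) auto
  finally show ?thesis .
qed

text \<open>Join a fixed \<open>z\<close> in \<open>A\<close> to every point of \<open>A\<close> by
  a base set inside \<open>D\<close>, and take the union of this star.\<close>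

lemma connectoid_finite_cover:
  assumes "connectoid S \<C>" "D \<in> \<C>" "finite A" "A \<subseteq> D"
  shows "\<exists>F. finite F \<and> F \<in> \<C> \<and> A \<subseteq> F \<and> F \<subseteq> D"
proof (cases "A = {}")
  case True
  then show ?thesis using connectoid_empty[OF assms(1)] by blast
next
  case False
  then obtain z where z: "z \<in> A" by blast
  obtain \<F> where base: "connectoid_base S \<F>" and \<C>: "\<C> = connected_sets S \<F>"
    using assms(1) unfolding connectoid_def by blast
  have "\<forall>x\<in>A. \<exists>F\<in>\<F>. F \<subseteq> D \<and> z \<in> F \<and> x \<in> F"
    using assms(2,4) z unfolding \<C> connected_sets_def by blast
  then obtain f where f: "\<And>x. x \<in> A \<Longrightarrow> f x \<in> \<F> \<and> f x \<subseteq> D \<and> z \<in> f x \<and> x \<in> f x" by metis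
  have "f x \<in> \<C> \<and> finite (f x)" if "x \<in> A" for x
    using f[OF that] base base_connected[OF base] unfolding \<C> connectoid_base_def by simp
  then have "\<Union> (f ` A) \<in> \<C>" "finite (\<Union> (f ` A))"
    using f assms(3) by (auto intro!: connectoid_Union[OF assms(1), of _ z])
  moreover have "A \<subseteq> \<Union> (f ` A)" "\<Union> (f ` A) \<subseteq> D" using f by auto
  ultimately show ?thesis by blast
qed

section \<open>Components of a subset\<close>

definition component :: "'a set set \<Rightarrow> 'a set \<Rightarrow> 'a \<Rightarrow> 'a set" where
  "component \<C> A x = \<Union>{C \<in> \<C>. C \<subseteq> A \<and> x \<in> C}"

lemma component_subset: "component \<C> A x \<subseteq> A"
  unfolding component_def by blast

lemma component_maximal: "C \<in> \<C> \<Longrightarrow> C \<subseteq> A \<Longrightarrow> x \<in> C \<Longrightarrow> C \<subseteq> component \<C> A x"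
  unfolding component_def by blast

lemma component_connected: "connectoid S \<C> \<Longrightarrow> component \<C> A x \<in> \<C>"
  unfolding component_def by (rule connectoid_Union[of _ _ _ x]) auto

lemma component_self: "connectoid S \<C> \<Longrightarrow> A \<subseteq> S \<Longrightarrow> x \<in> A \<Longrightarrow> x \<in> component \<C> A x"
  using connectoid_singleton unfolding component_def by fastforce

lemma component_eq:
  assumes "connectoid S \<C>" "y \<in> component \<C> A x"
  shows "component \<C> A y = component \<C> A x"
proof -
  have "x \<in> component \<C> A x" using assms(2) unfolding component_def by blast
  then have "component \<C> A x \<subseteq> component \<C> A y" "x \<in> component \<C> A y"
    using component_maximal[OF component_connected[OF assms(1)] component_subset assms(2)] by auto
  then show ?thesis
    using component_maximal[OF component_connected[OF assms(1)] component_subset, of x A y] by blast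
qed

section \<open>Normal trees from iterated components\<close>

text \<open>A state \<open>(B, F, D)\<close> records the current component \<open>D\<close>, the finite connected set \<open>F\<close> whose
  elements in \<open>D\<close> are being turned into vertices, and the component \<open>B \<supseteq> F\<close> in which \<open>F\<close> was
  chosen. Once a component \<open>E\<close> misses \<open>F\<close>, a new finite set is chosen inside \<open>E\<close>; it swallows all
  that a finite connected set linking \<open>F\<close> to \<open>E\<close> within \<open>B\<close> has in \<open>E\<close>, so that later components
  are disjoint from this link. The links then form a necklace along each ray.\<close>

type_synonym 'a state = "'a set \<times> 'a set \<times> 'a set"

locale selected_connectoid =
  fixes S :: "'a set" and \<C> :: "'a set set" and t :: "'a set \<Rightarrow> 'a"
  assumes connectoid: "connectoid S \<C>"
    and S_connected: "S \<in> \<C>"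
    and S_nonempty: "S \<noteq> {}"
    and t_in: "D \<in> \<C> \<Longrightarrow> D \<noteq> {} \<Longrightarrow> t D \<in> D"
begin

text \<open>The set \<open>G\<close> is the link that later becomes part of a necklace. The
  condition \<open>t E \<in> F'\<close> ensures that every phase uses the prescribed element of its
  base component.\<close>

definition linked :: "'a set \<Rightarrow> 'a set \<Rightarrow> 'a set \<Rightarrow> 'a set \<Rightarrow> bool" where
  "linked B F E F' \<longleftrightarrow> finite F' \<and> F' \<in> \<C> \<and> F' \<subseteq> E \<and> t E \<in> F' \<and>
     (\<exists>G. finite G \<and> G \<in> \<C> \<and> G \<subseteq> B \<and> G \<inter> F \<noteq> {} \<and> G \<inter> E \<noteq> {} \<and> G \<inter> E \<subseteq> F')"

definition start :: "'a state" where
  "start = (S, {t S}, S)"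

fun step :: "'a state \<Rightarrow> 'a set \<Rightarrow> 'a state" where
  "step (B, F, D) E = (if E \<inter> F \<noteq> {} then (B, F, E) else (E, SOME F'. linked B F E F', E))"

fun valid :: "'a state \<Rightarrow> bool" where
  "valid (B, F, D) \<longleftrightarrow> B \<in> \<C> \<and> F \<in> \<C> \<and> D \<in> \<C> \<and> finite F \<and> F \<subseteq> B \<and> D \<subseteq> B \<and>
     F \<inter> D \<noteq> {} \<and> t B \<in> F"

fun pick :: "'a state \<Rightarrow> 'a" where
  "pick (B, F, D) = (SOME x. x \<in> F \<inter> D)"

text \<open>First \<open>G\<close> is a finite connected set in \<open>B\<close> joining a point of
  \<open>F\<close> to a point of \<open>E\<close>; then \<open>F'\<close> is a finite connected set
  in \<open>E\<close> that covers \<open>t E\<close> and the finite trace of \<open>G\<close> on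
  \<open>E\<close>.\<close>

lemma linked_ex:
  assumes "valid (B, F, D)" "E \<in> \<C>" "E \<noteq> {}" "E \<subseteq> B"
  shows "\<exists>F'. linked B F E F'"
proof -
  obtain a b where ab: "a \<in> F" "a \<in> B" "b \<in> E" "b \<in> B" using assms by auto
  then obtain G where G: "finite G" "G \<in> \<C>" "{a, b} \<subseteq> G" "G \<subseteq> B"
    using connectoid_finite_cover[OF connectoid, of B "{a, b}"] assms(1) by auto
  obtain F' where "finite F'" "F' \<in> \<C>" "insert (t E) (G \<inter> E) \<subseteq> F'" "F' \<subseteq> E"
    using connectoid_finite_cover[OF connectoid, of E "insert (t E) (G \<inter> E)"] assms(2,3) G(1) t_in
    by auto
  moreover have "G \<inter> F \<noteq> {}" "G \<inter> E \<noteq> {}" using G(3) ab(1,3) by auto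
  ultimately show ?thesis
    using G(1,2,4) unfolding linked_def by (intro exI[of _ F'] conjI exI[of _ G]) simp_all
qed

lemma linked_step:
  assumes "valid (B, F, D)" "E \<in> \<C>" "E \<noteq> {}" "E \<subseteq> B" "E \<inter> F = {}"
  shows "\<exists>F'. step (B, F, D) E = (E, F', E) \<and> linked B F E F'"
  using someI_ex[OF linked_ex[OF assms(1-4)]] assms(5) by simp

lemma valid_start: "valid start"
  using connectoid_singleton[OF connectoid] S_connected S_nonempty t_in[of S]
  by (simp add: start_def)

lemma valid_step:
  assumes "valid (B, F, D)" "E \<in> \<C>" "E \<noteq> {}" "E \<subseteq> D"
  shows "valid (step (B, F, D) E)"
proof (cases "E \<inter> F = {}")
  case True
  moreover have "E \<subseteq> B" using assms by auto
  ultimately obtain F' where "step (B, F, D) E = (E, F', E)" "linked B F E F'"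
    using linked_step[OF assms(1-3)] by blast
  then show ?thesis using assms(2,3) t_in[of E] unfolding linked_def by auto
next
  case False
  then show ?thesis using assms by auto
qed

lemma pick_in: "valid (B, F, D) \<Longrightarrow> pick (B, F, D) \<in> F \<inter> D"
  using someI_ex[of "\<lambda>x. x \<in> F \<inter> D"] by auto

section \<open>Iterating the choices towards a point\<close>

abbreviation st_base :: "'a state \<Rightarrow> 'a set" where "st_base \<sigma> \<equiv> fst \<sigma>"
abbreviation st_fin :: "'a state \<Rightarrow> 'a set" where "st_fin \<sigma> \<equiv> fst (snd \<sigma>)"
abbreviation st_cur :: "'a state \<Rightarrow> 'a set" where "st_cur \<sigma> \<equiv> snd (snd \<sigma>)"

lemma validD:
  assumes "valid \<sigma>"
  shows "st_base \<sigma> \<in> \<C>" "st_fin \<sigma> \<in> \<C>" "st_cur \<sigma> \<in> \<C>" "finite (st_fin \<sigma>)"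
    "st_fin \<sigma> \<subseteq> st_base \<sigma>" "st_cur \<sigma> \<subseteq> st_base \<sigma>" "st_cur \<sigma> \<noteq> {}" "t (st_base \<sigma>) \<in> st_fin \<sigma>"
    "pick \<sigma> \<in> st_fin \<sigma> \<inter> st_cur \<sigma>"
proof -
  obtain B F D where \<sigma>: "\<sigma> = (B, F, D)" by (cases \<sigma>)
  show "st_base \<sigma> \<in> \<C>" "st_fin \<sigma> \<in> \<C>" "st_cur \<sigma> \<in> \<C>" "finite (st_fin \<sigma>)"
    "st_fin \<sigma> \<subseteq> st_base \<sigma>" "st_cur \<sigma> \<subseteq> st_base \<sigma>" "st_cur \<sigma> \<noteq> {}" "t (st_base \<sigma>) \<in> st_fin \<sigma>"
    using assms unfolding \<sigma> by auto
  show "pick \<sigma> \<in> st_fin \<sigma> \<inter> st_cur \<sigma>"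
    using pick_in assms unfolding \<sigma> fst_conv snd_conv by blast
qed

text \<open>\<open>st n x\<close> follows the components containing \<open>x\<close>. Once
  \<open>x\<close> itself is picked, the next component at \<open>x\<close> is empty, and all
  further states are meaningless; hence the recurring premise
  \<open>x \<in> cur n x\<close>.\<close>

primrec st :: "nat \<Rightarrow> 'a \<Rightarrow> 'a state" where
  "st 0 x = start"
| "st (Suc n) x = step (st n x) (component \<C> (st_cur (st n x) - {pick (st n x)}) x)"

abbreviation cur :: "nat \<Rightarrow> 'a \<Rightarrow> 'a set" where
  "cur n x \<equiv> st_cur (st n x)"

abbreviation anc :: "nat \<Rightarrow> 'a \<Rightarrow> 'a" where
  "anc n x \<equiv> pick (st n x)"

lemma cur_0: "cur 0 x = S"
  by (simp add: start_def)

lemma cur_Suc: "cur (Suc n) x = component \<C> (cur n x - {anc n x}) x"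
  by (cases "st n x") auto

lemma cur_Suc_subset: "cur (Suc n) x \<subseteq> cur n x - {anc n x}"
  unfolding cur_Suc by (rule component_subset)

lemma cur_antimono: "m \<le> n \<Longrightarrow> cur n x \<subseteq> cur m x"
  using lift_Suc_antimono_le[of "\<lambda>n. cur n x" m n] cur_Suc_subset by blast

lemma st_Suc: "st (Suc n) x = step (st n x) (cur (Suc n) x)"
  unfolding cur_Suc by simp

lemma valid_st: "x \<in> cur n x \<Longrightarrow> valid (st n x)"
proof (induction n)
  case 0
  then show ?case by (simp add: valid_start)
next
  case (Suc n)
  obtain B F D where eq: "st n x = (B, F, D)" by (cases "st n x")
  have sub: "cur (Suc n) x \<subseteq> D"
    using cur_Suc_subset[of n x] unfolding eq by auto
  then have "x \<in> cur n x" using Suc.prems unfolding eq by auto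
  then have "valid (B, F, D)" using Suc.IH unfolding eq by blast
  moreover have "cur (Suc n) x \<in> \<C>"
    unfolding cur_Suc by (rule component_connected[OF connectoid])
  moreover have "cur (Suc n) x \<noteq> {}" using Suc.prems by blast
  ultimately have "valid (step (B, F, D) (cur (Suc n) x))"
    using sub by (rule valid_step)
  then show ?case by (subst st_Suc) (simp only: eq)
qed

text \<open>Points that are still together in one component have had the same history.\<close>

lemma st_eq: "y \<in> cur n x \<Longrightarrow> m \<le> n \<Longrightarrow> st m y = st m x"
proof (induction m)
  case (Suc m)
  then have "st m y = st m x" "y \<in> cur (Suc m) x"
    using cur_antimono[of "Suc m" n x] by auto
  then show ?case
    using component_eq[OF connectoid, of y "cur m x - {anc m x}" x] cur_Suc[of m x] by simp
qed simp

lemma cur_connected: "x \<in> cur n x \<Longrightarrow> cur n x \<in> \<C>"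
  by (rule validD(3)[OF valid_st])

lemma anc_in_cur: "x \<in> cur n x \<Longrightarrow> anc n x \<in> cur n x"
  using validD(9)[OF valid_st] by blast

lemma cur_SucI: "x \<in> cur n x \<Longrightarrow> x \<noteq> anc n x \<Longrightarrow> x \<in> cur (Suc n) x"
  unfolding cur_Suc
  using connectoid_subset[OF connectoid cur_connected[of x n]]
  by (intro component_self[OF connectoid]) auto

section \<open>Picked points as the vertices of a tree\<close>

definition vertex_at :: "nat \<Rightarrow> 'a \<Rightarrow> bool" where
  "vertex_at n x \<longleftrightarrow> x \<in> cur n x \<and> anc n x = x"

definition V :: "'a set" where
  "V = {x. \<exists>n. vertex_at n x}"

definition dep :: "'a \<Rightarrow> nat" where
  "dep x = (THE n. vertex_at n x)"

text \<open>If \<open>x\<close> were in \<open>cur m y\<close>, then \<open>x\<close> and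
  \<open>y\<close> would share their states up to \<open>n\<close>, so \<open>x\<close> would also
  be the point deleted at step \<open>n\<close> on the way to \<open>y\<close>.\<close>

lemma vertex_at_not_later: "vertex_at n x \<Longrightarrow> n < m \<Longrightarrow> x \<notin> cur m y"
  using cur_antimono[of "Suc n" m y] cur_Suc_subset[of n y] st_eq[of x m y n]
  unfolding vertex_at_def by auto

lemma dep_eqI: "vertex_at n x \<Longrightarrow> dep x = n"
  unfolding dep_def
  by (rule the_equality) (metis linorder_neqE_nat vertex_at_def vertex_at_not_later)+

lemma vertex_at_dep: "x \<in> V \<Longrightarrow> vertex_at (dep x) x"
  using dep_eqI unfolding V_def by auto

lemma vertex_at_anc: "x \<in> cur n x \<Longrightarrow> vertex_at n (anc n x)"
  using anc_in_cur[of x n] st_eq[of "anc n x" n x n] unfolding vertex_at_def by simp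

lemma in_cur_dep: "x \<in> V \<Longrightarrow> n \<le> dep x \<Longrightarrow> x \<in> cur n x"
  using vertex_at_dep[of x] cur_antimono[of n "dep x" x] unfolding vertex_at_def by auto

lemma in_cur_le_dep: "x \<in> V \<Longrightarrow> x \<in> cur n y \<Longrightarrow> n \<le> dep x"
  using vertex_at_dep vertex_at_not_later not_less by metis

lemma V_subset: "V \<subseteq> S"
  using in_cur_dep[of _ 0] cur_0 by auto

lemma start_in_cur: "x \<in> S \<Longrightarrow> x \<in> cur 0 x"
  using cur_0 by simp

sublocale levelled V dep anc "pick start"
proof
  obtain x where x: "x \<in> S" using S_nonempty by blast
  show "pick start \<in> V"
    using vertex_at_anc[OF start_in_cur[OF x]] unfolding V_def by auto
  fix x m
  assume x: "x \<in> V"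
  show "anc 0 x = pick start" by simp
  show "anc (dep x) x = x" using vertex_at_dep[OF x] by (simp add: vertex_at_def)
  assume m: "m \<le> dep x"
  show "anc m x \<in> V" "dep (anc m x) = m"
    using vertex_at_anc[OF in_cur_dep[OF x m]] dep_eqI unfolding V_def by auto
  fix k
  assume "k \<le> m"
  then show "anc k (anc m x) = anc k x"
    using st_eq[OF anc_in_cur[OF in_cur_dep[OF x m]]] by simp
qed

lemma st_anc: "x \<in> V \<Longrightarrow> m \<le> dep x \<Longrightarrow> k \<le> m \<Longrightarrow> st k (anc m x) = st k x"
  using st_eq[OF anc_in_cur[OF in_cur_dep]] by simp

lemma weak_normal_tree: "weak_normal_tree S \<C> tree"
proof -
  have "\<exists>w\<in>C. tree_le tree w u \<and> tree_le tree w v"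
    if C: "C \<in> \<C>" and u: "u \<in> C" "u \<in> V" and v: "v \<in> C" "v \<in> V" for C u v
  proof -
    \<comment> \<open>\<open>C\<close> starts inside \<open>S\<close> but cannot stay inside the
      components forever, since \<open>u\<close> leaves them after step
      \<open>dep u\<close>.\<close>
    have "\<exists>n. C \<subseteq> cur n u \<and> \<not> C \<subseteq> cur (Suc n) u"
    proof (rule ccontr)
      assume "\<not> ?thesis"
      then have "C \<subseteq> cur n u" for n
        using connectoid_subset[OF connectoid C] cur_0 by (induction n) auto
      then show False
        using u vertex_at_not_later[OF vertex_at_dep, of u "Suc (dep u)" u] by blast
    qed
    then obtain n where n: "C \<subseteq> cur n u" "\<not> C \<subseteq> cur (Suc n) u" by blast
    \<comment> \<open>If the point deleted at this step missed \<open>C\<close>, the connected set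
      \<open>C\<close> would survive inside a single component. So \<open>C\<close> contains this
      point, which is an ancestor of both \<open>u\<close> and \<open>v\<close>.\<close>
    then have "anc n u \<in> C"
      using component_maximal[OF C, of "cur n u - {anc n u}" u] u(1) unfolding cur_Suc by blast
    moreover have "st n v = st n u" using n v st_eq by blast
    moreover have "n \<le> dep u" "n \<le> dep v"
      using n u v in_cur_le_dep by blast+
    ultimately show ?thesis
      using tree_le_iff[OF u(2)] tree_le_iff[OF v(2)] by metis
  qed
  moreover have "\<exists>C\<in>\<C>. u \<in> C \<and> v \<in> C \<and> \<not> (\<exists>w\<in>C. tree_less tree w u)"
    if v: "v \<in> V" and le: "tree_le tree u v" for u v
  proof -
    obtain m where m: "m \<le> dep v" "u = anc m v" using le tree_le_iff[OF v] by blast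
    note cur = in_cur_dep[OF v m(1)]
    have u: "u \<in> V" "dep u = m" "u \<in> cur m v"
      using m anc_in[OF v] dep_anc[OF v] anc_in_cur[OF cur] by auto
    have False if w: "w \<in> cur m v" "tree_less tree w u" for w
    proof -
      obtain k where k: "k \<le> m" "w = anc k u" "w \<noteq> u"
        using w(2) tree_le_iff[OF u(1)] u(2) unfolding tree_less_def by blast
      then have "k < m" using anc_dep[OF u(1)] u(2) by (metis le_neq_implies_less)
      moreover have "vertex_at k w"
        using k vertex_at_anc in_cur_dep[OF u(1)] u(2) by blast
      ultimately show False using vertex_at_not_later w(1) by blast
    qed
    \<comment> \<open>The witness for condition (b) is \<open>cur m v\<close>, the component in
      which \<open>u\<close> was picked: all proper ancestors of \<open>u\<close> were deleted
      before.\<close>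
    then show ?thesis using cur cur_connected[OF cur] u(3) by blast
  qed
  ultimately show ?thesis
    using rooted_tree V_subset unfolding weak_normal_tree_def by auto
qed

section \<open>Infinite runs, their phases and their necklaces\<close>

definition run :: "(nat \<Rightarrow> 'a state) \<Rightarrow> bool" where
  "run \<sigma> \<longleftrightarrow> (\<forall>n. valid (\<sigma> n) \<and> st_cur (\<sigma> (Suc n)) \<subseteq> st_cur (\<sigma> n) - {pick (\<sigma> n)} \<and>
     \<sigma> (Suc n) = step (\<sigma> n) (st_cur (\<sigma> (Suc n))))"

lemma step_same:
  "E \<inter> st_fin \<sigma> \<noteq> {} \<Longrightarrow> step \<sigma> E = (st_base \<sigma>, st_fin \<sigma>, E)"
  by (cases \<sigma>) auto

lemma step_new:
  assumes "valid \<sigma>" "E \<in> \<C>" "E \<noteq> {}" "E \<subseteq> st_base \<sigma>" "E \<inter> st_fin \<sigma> = {}"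
  shows "st_base (step \<sigma> E) = E" "linked (st_base \<sigma>) (st_fin \<sigma>) E (st_fin (step \<sigma> E))"
proof -
  obtain B F D where \<sigma>: "\<sigma> = (B, F, D)" by (cases \<sigma>)
  obtain F' where "step (B, F, D) E = (E, F', E)" "linked B F E F'"
    using linked_step[of B F D E] assms unfolding \<sigma> by auto
  then show "st_base (step \<sigma> E) = E" "linked (st_base \<sigma>) (st_fin \<sigma>) E (st_fin (step \<sigma> E))"
    unfolding \<sigma> by simp_all
qed

lemma run_same:
  assumes "run \<sigma>" "st_cur (\<sigma> (Suc n)) \<inter> st_fin (\<sigma> n) \<noteq> {}"
  shows "st_base (\<sigma> (Suc n)) = st_base (\<sigma> n)" "st_fin (\<sigma> (Suc n)) = st_fin (\<sigma> n)"
  using assms(1) step_same[OF assms(2)] unfolding run_def by (metis fst_conv snd_conv)+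

text \<open>While a finite set \<open>F\<close> stays in use, every step deletes a point of
  \<open>F\<close> from the current component, so the number of points of \<open>F\<close> left
  there drops strictly.\<close>

lemma run_new:
  assumes "run \<sigma>"
  shows "\<exists>j\<ge>m. st_cur (\<sigma> (Suc j)) \<inter> st_fin (\<sigma> j) = {}"
proof (rule ccontr)
  assume none: "\<not> ?thesis"
  have same: "st_fin (\<sigma> (m + i)) = st_fin (\<sigma> m)" for i
    using run_same(2)[OF assms] none by (induction i) auto
  have valid: "valid (\<sigma> n)" for n using assms by (simp add: run_def)
  let ?c = "\<lambda>i. card (st_fin (\<sigma> m) \<inter> st_cur (\<sigma> (m + i)))"
  have dec: "?c (Suc i) < ?c i" for i
  proof (rule psubset_card_mono)
    show "finite (st_fin (\<sigma> m) \<inter> st_cur (\<sigma> (m + i)))" using validD(4)[OF valid] by simp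
    show "st_fin (\<sigma> m) \<inter> st_cur (\<sigma> (m + Suc i)) \<subset> st_fin (\<sigma> m) \<inter> st_cur (\<sigma> (m + i))"
      using validD(9)[OF valid, of "m + i"] assms same[of i] unfolding run_def by fastforce
  qed
  have "?c i + i \<le> ?c 0" for i
  proof (induction i)
    case (Suc i)
    then show ?case using dec[of i] by linarith
  qed simp
  from this[of "Suc (?c 0)"] show False by simp
qed

text \<open>The run is cut into the maximal stretches with constant base and finite set:
  \<open>X k\<close> is the base component of the \<open>k\<close>-th stretch and \<open>Y k\<close>
  its finite set.\<close>

lemma run_phases:
  assumes "run \<sigma>"
  obtains X Y where
    "\<And>k. X k \<in> \<C>" "\<And>k. Y k \<in> \<C>" "\<And>k. finite (Y k)" "\<And>k. t (X k) \<in> Y k"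
    "\<And>k. X (Suc k) \<subseteq> X k" "\<And>k. Y k \<subseteq> X k" "\<And>k. X (Suc k) \<inter> Y k = {}"
    "\<And>k. linked (X k) (Y k) (X (Suc k)) (Y (Suc k))"
    "\<And>k. \<exists>n. st_cur (\<sigma> n) \<subseteq> X k" "\<And>n. \<exists>k. pick (\<sigma> n) \<in> Y k"
proof -
  define new where "new j \<longleftrightarrow> st_cur (\<sigma> (Suc j)) \<inter> st_fin (\<sigma> j) = {}" for j
  \<comment> \<open>\<open>s k\<close> is the first step of phase \<open>k\<close> and
    \<open>e (s k)\<close> its last one, after which the component misses the finite set.\<close>
  define e where "e m = (LEAST j. m \<le> j \<and> new j)" for m
  define s where "s = rec_nat 0 (\<lambda>k m. Suc (e m))"
  define X Y where "X k = st_base (\<sigma> (s k))" and "Y k = st_fin (\<sigma> (s k))" for k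
  have s: "s 0 = 0" "s (Suc k) = Suc (e (s k))" for k by (simp_all add: s_def)
  have e: "m \<le> e m" "new (e m)" for m
    using LeastI_ex[of "\<lambda>j. m \<le> j \<and> new j"] run_new[OF assms, of m] by (auto simp: e_def new_def)
  have not_new: "\<not> new j" if "m \<le> j" "j < e m" for m j
    using not_less_Least[of j "\<lambda>j. m \<le> j \<and> new j"] that by (auto simp: e_def)
  have valid: "valid (\<sigma> n)" for n using assms by (simp add: run_def)
  have same: "st_base (\<sigma> j) = st_base (\<sigma> m) \<and> st_fin (\<sigma> j) = st_fin (\<sigma> m)"
    if "m \<le> j" "j \<le> e m" for m j
    using that
  proof (induction j rule: dec_induct)
    case (step j)
    then show ?case using run_same[OF assms, of j] not_new[of m j] by (auto simp: new_def)
  qed simp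
  have cur_e: "st_cur (\<sigma> (s (Suc k))) \<inter> Y k = {}" "st_cur (\<sigma> (s (Suc k))) \<subseteq> X k" for k
  proof -
    have eq: "st_base (\<sigma> (e (s k))) = X k" "st_fin (\<sigma> (e (s k))) = Y k"
      using same[of "s k" "e (s k)"] e(1) by (simp_all add: X_def Y_def)
    show "st_cur (\<sigma> (s (Suc k))) \<inter> Y k = {}"
      using e(2)[of "s k"] eq by (simp add: new_def s)
    have "st_cur (\<sigma> (s (Suc k))) \<subseteq> st_cur (\<sigma> (e (s k)))"
      using assms unfolding run_def s by blast
    then show "st_cur (\<sigma> (s (Suc k))) \<subseteq> X k"
      using validD(6)[OF valid[of "e (s k)"]] eq by simp
  qed
  have new_step: "X (Suc k) = st_cur (\<sigma> (s (Suc k)))"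
    "linked (X k) (Y k) (st_cur (\<sigma> (s (Suc k)))) (Y (Suc k))" for k
  proof -
    have eq: "st_base (\<sigma> (e (s k))) = X k" "st_fin (\<sigma> (e (s k))) = Y k"
      using same[of "s k" "e (s k)"] e(1) by (simp_all add: X_def Y_def)
    have "\<sigma> (s (Suc k)) = step (\<sigma> (e (s k))) (st_cur (\<sigma> (s (Suc k))))"
      using assms unfolding run_def s by blast
    then show "X (Suc k) = st_cur (\<sigma> (s (Suc k)))"
      "linked (X k) (Y k) (st_cur (\<sigma> (s (Suc k)))) (Y (Suc k))"
      using step_new[OF valid[of "e (s k)"] validD(3,7)[OF valid[of "s (Suc k)"]]] cur_e[of k] eq
      unfolding X_def[of "Suc k"] Y_def[of "Suc k"] by metis+
  qed
  have "\<exists>k. s k \<le> n \<and> n \<le> e (s k)" for n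
  proof (induction n)
    case 0
    then show ?case using s(1) by (metis le0)
  next
    case (Suc n)
    then obtain k where k: "s k \<le> n" "n \<le> e (s k)" by blast
    show ?case
    proof (cases "n = e (s k)")
      case True
      then show ?thesis using s(2)[of k] e(1)[of "s (Suc k)"] by (metis order_refl)
    next
      case False
      then show ?thesis using k by (intro exI[of _ k]) simp
    qed
  qed
  then have pick: "\<exists>k. pick (\<sigma> n) \<in> Y k" for n
    using same validD(9)[OF valid[of n]] unfolding Y_def by (metis IntD1)
  show ?thesis
  proof (rule that[of X Y])
    show "X (Suc k) \<subseteq> X k" "X (Suc k) \<inter> Y k = {}" for k using cur_e new_step(1) by simp_all
    show "linked (X k) (Y k) (X (Suc k)) (Y (Suc k))" for k using new_step by simp
    show "\<exists>n. st_cur (\<sigma> n) \<subseteq> X k" for k using validD(6)[OF valid] unfolding X_def by blast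
  qed (use pick validD[OF valid] in \<open>auto simp: X_def Y_def\<close>)
qed

lemma run_necklace:
  assumes "run \<sigma>"
  shows "\<exists>N. necklace \<C> N \<and> range (\<lambda>n. pick (\<sigma> n)) \<subseteq> N"
proof -
  obtain X Y where X: "\<And>k. X k \<in> \<C>" "\<And>k. X (Suc k) \<subseteq> X k"
    and Y: "\<And>k. Y k \<in> \<C>" "\<And>k. finite (Y k)" "\<And>k. t (X k) \<in> Y k" "\<And>k. Y k \<subseteq> X k"
      "\<And>k. X (Suc k) \<inter> Y k = {}" "\<And>n. \<exists>k. pick (\<sigma> n) \<in> Y k"
    and linked: "\<And>k. linked (X k) (Y k) (X (Suc k)) (Y (Suc k))"
    using run_phases[OF assms] by metis
  obtain G where G: "\<And>k. finite (G k)" "\<And>k. G k \<in> \<C>" "\<And>k. G k \<subseteq> X k"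
    "\<And>k. G k \<inter> Y k \<noteq> {}" "\<And>k. G k \<inter> X (Suc k) \<noteq> {}" "\<And>k. G k \<inter> X (Suc k) \<subseteq> Y (Suc k)"
    using linked unfolding linked_def by metis
  \<comment> \<open>Consecutive beads overlap in \<open>Y (Suc k)\<close>. Each bead is connected,
    because the link \<open>G k\<close> meets \<open>Y k\<close> and meets \<open>X (Suc k)\<close>
    only inside \<open>Y (Suc k)\<close>.\<close>
  define H where "H k = Y k \<union> G k \<union> Y (Suc k)" for k
  have H_conn: "H k \<in> \<C>" for k
    unfolding H_def using G(2,4,5,6)[of k] Y(1)
    by (intro connectoid_Un[OF connectoid]) auto
  have H_fin: "finite (H k)" for k using Y G by (simp add: H_def)
  have H_sub: "H k \<subseteq> X k" for k using Y(4) G(3) X(2) unfolding H_def by blast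
  have H_next: "H k \<inter> H (Suc k) \<noteq> {}" for k using Y(3)[of "Suc k"] unfolding H_def by blast
  \<comment> \<open>What \<open>G k\<close> has in \<open>X (Suc k)\<close> was swallowed by
    \<open>Y (Suc k)\<close>, and this set is disjoint from \<open>X (Suc (Suc k))\<close>. Beads at
    distance two or more are therefore disjoint.\<close>
  have "H k \<inter> X (Suc (Suc k)) = {}" for k
    using Y(5)[of k] Y(5)[of "Suc k"] G(6)[of k] X(2)[of "Suc k"] unfolding H_def by blast
  then have far: "H i \<inter> H j = {}" if "Suc (Suc i) \<le> j" for i j
    using lift_Suc_antimono_le[of X, OF X(2) that] H_sub[of j] by blast
  have meet: "H i \<inter> H j \<noteq> {} \<longleftrightarrow> \<bar>int i - int j\<bar> \<le> 1" for i j
  proof -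
    consider "i = j" | "j = Suc i" | "i = Suc j" | "Suc (Suc i) \<le> j" | "Suc (Suc j) \<le> i"
      by linarith
    then show ?thesis
    proof cases
      case 1
      then show ?thesis using H_next[of i] by auto
    next
      case 2
      then show ?thesis using H_next[of i] by auto
    next
      case 3
      then show ?thesis using H_next[of j] by (auto simp: Int_commute)
    next
      case 4
      then show ?thesis using far[of i j] by auto
    next
      case 5
      then show ?thesis using far[of j i] by (auto simp: Int_commute)
    qed
  qed
  have "necklace \<C> (\<Union>n. H n)"
    unfolding necklace_def
  proof (intro conjI exI[of _ H] allI)
    show "(\<Union>n. H n) \<in> \<C>"
      by (rule connectoid_UN_chain[of S \<C> H, OF connectoid H_conn H_next])
  qed (rule H_fin H_conn refl meet)+
  moreover have "range (\<lambda>n. pick (\<sigma> n)) \<subseteq> (\<Union>n. H n)"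
    using Y(6) unfolding H_def by blast
  ultimately show ?thesis by blast
qed

text \<open>The target \<open>x n\<close> may vary with \<open>n\<close> as long as the histories
  agree. Rays take \<open>x n\<close> to be the \<open>n\<close>-th vertex; a point that is never
  picked gives a constant target.\<close>

lemma run_st:
  assumes "\<And>n. \<sigma> n = st n (x n)" "\<And>n. st n (x (Suc n)) = st n (x n)" "\<And>n. x n \<in> cur n (x n)"
  shows "run \<sigma>"
  unfolding run_def
proof (intro allI conjI)
  fix n
  have Suc: "\<sigma> (Suc n) = step (\<sigma> n) (component \<C> (st_cur (\<sigma> n) - {pick (\<sigma> n)}) (x (Suc n)))"
    using assms(1)[of n] assms(1)[of "Suc n"] assms(2)[of n] by simp
  moreover have "st_cur (step \<tau> E) = E" for \<tau> E by (cases \<tau>) simp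
  ultimately have cur: "st_cur (\<sigma> (Suc n)) = component \<C> (st_cur (\<sigma> n) - {pick (\<sigma> n)}) (x (Suc n))"
    by metis
  show "valid (\<sigma> n)" using assms(1,3) valid_st by simp
  show "st_cur (\<sigma> (Suc n)) \<subseteq> st_cur (\<sigma> n) - {pick (\<sigma> n)}"
    unfolding cur by (rule component_subset)
  show "\<sigma> (Suc n) = step (\<sigma> n) (st_cur (\<sigma> (Suc n)))" unfolding cur by (rule Suc)
qed

lemma normal_tree: "normal_tree S \<C> tree"
  unfolding normal_tree_def
proof (intro conjI allI impI weak_normal_tree)
  fix R
  assume "root_ray tree R"
  note R = root_rayD[OF this]
  have cur: "R n \<in> cur n (R n)" for n using in_cur_dep[OF R(1)] R(2) by simp
  have "st n (R (Suc n)) = st n (R n)" for n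
    using st_anc[OF R(1), of n "Suc n" n] R(2)[of "Suc n"] R(3)[of n "Suc n"] by simp
  then have "run (\<lambda>n. st n (R n))" using cur by (intro run_st[of _ R]) auto
  then obtain N where N: "necklace \<C> N" "range (\<lambda>n. anc n (R n)) \<subseteq> N"
    using run_necklace by blast
  \<comment> \<open>\<open>R n\<close> is the point picked at step \<open>n\<close> on the way to
    itself, so the necklace contains the whole ray.\<close>
  have "range R - N = {}" using N(2) R(3)[of _ _] by auto
  then show "\<exists>N. necklace \<C> N \<and> finite (range R - N)" using N(1) by (metis finite.emptyI)
qed

text \<open>If \<open>v\<close> were never picked, it would stay in all components of an infinite
  run. The base components of the phases would then all contain \<open>v\<close> and have pairwise
  different values of \<open>t\<close>.\<close>

lemma tree_contains:
  assumes "v \<in> S" "finite (t ` {D \<in> \<C>. v \<in> D})"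
  shows "v \<in> verts tree"
proof (rule ccontr)
  assume "v \<notin> verts tree"
  then have "v \<notin> V" by simp
  then have not_at: "\<not> vertex_at n v" for n unfolding V_def by blast
  have cur: "v \<in> cur n v" for n
  proof (induction n)
    case 0
    then show ?case using start_in_cur[OF assms(1)] .
  next
    case (Suc n)
    then show ?case using cur_SucI not_at unfolding vertex_at_def by metis
  qed
  have "run (\<lambda>n. st n v)" using cur by (intro run_st[of _ "\<lambda>n. v"]) auto
  then obtain X Y where X: "\<And>k. X k \<in> \<C>" "\<And>k. X (Suc k) \<subseteq> X k" "\<And>k. \<exists>n. cur n v \<subseteq> X k"
    and Y: "\<And>k. t (X k) \<in> Y k" "\<And>k. Y k \<subseteq> X k" "\<And>k. X (Suc k) \<inter> Y k = {}"
    using run_phases by metis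
  \<comment> \<open>\<open>t (X i)\<close> lies in \<open>Y i\<close>, which all later base
    components avoid, whereas \<open>t (X j)\<close> lies in \<open>X j\<close>.\<close>
  have ne: "t (X i) \<noteq> t (X j)" if "i < j" for i j
  proof -
    have "X j \<subseteq> X (Suc i)" using lift_Suc_antimono_le[of X, OF X(2), of "Suc i" j] that by simp
    then show ?thesis using Y(1)[of i] Y(1)[of j] Y(2)[of j] Y(3)[of i] by (metis IntI empty_iff subsetD)
  qed
  have "inj (\<lambda>k. t (X k))" by (rule injI) (metis ne linorder_neqE_nat)
  then have "infinite (range (\<lambda>k. t (X k)))" using finite_imageD infinite_UNIV_nat by blast
  moreover have "range (\<lambda>k. t (X k)) \<subseteq> t ` {D \<in> \<C>. v \<in> D}" using X cur by blast
  ultimately show False using assms(2) finite_subset by blast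
qed

end

section \<open>The normal tree of the subconnectoid\<close>

theorem corollary3p3:
  fixes S U :: "'a set" and \<C> :: "'a set set"
  assumes "connectoid S \<C>"
    and "U \<subseteq> S"
    and "\<exists>T. normal_tree S \<C> T \<and> U \<subseteq> verts T"
  shows "\<forall>S' \<C>'. subconnectoid S' \<C>' S \<C> \<and> connected_connectoid S' \<C>' \<and> S' \<noteq> {} \<longrightarrow>
           (\<exists>T'. normal_tree S' \<C>' T' \<and> U \<inter> S' \<subseteq> verts T')"
proof (intro allI impI)
  fix S' \<C>'
  assume sub: "subconnectoid S' \<C>' S \<C> \<and> connected_connectoid S' \<C>' \<and> S' \<noteq> {}"
  obtain T where T: "weak_normal_tree S \<C> T" "U \<subseteq> verts T"
    using assms(3) unfolding normal_tree_def by blast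
  \<comment> \<open>For \<open>D\<close> meeting \<open>verts T\<close>, \<open>u\<close> is the
    least such vertex in the order of \<open>T\<close>; it exists because \<open>D\<close> is also
    connected in the larger connectoid. If \<open>D\<close> is nonempty and misses
    \<open>verts T\<close>, any element of \<open>D\<close> serves.\<close>
  have "\<exists>u. (D \<noteq> {} \<longrightarrow> u \<in> D) \<and> (\<forall>v \<in> D \<inter> verts T. tree_le T u v)" if "D \<in> \<C>'" for D
  proof (cases "D \<inter> verts T = {}")
    case False
    have "D \<in> \<C>" using that sub unfolding subconnectoid_def by blast
    from weak_normal_tree_minimum[OF T(1) this False] show ?thesis by blast
  qed blast
  then obtain t where t: "\<And>D. D \<in> \<C>' \<Longrightarrow> D \<noteq> {} \<Longrightarrow> t D \<in> D"
    "\<And>D v. D \<in> \<C>' \<Longrightarrow> v \<in> D \<Longrightarrow> v \<in> verts T \<Longrightarrow> tree_le T (t D) v"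
    by (metis IntI)
  interpret selected_connectoid S' \<C>' t
    by unfold_locales (use sub t(1) in \<open>auto simp: connected_connectoid_def\<close>)
  have "v \<in> verts tree" if "v \<in> U \<inter> S'" for v
  proof (rule tree_contains)
    show "finite (t ` {D \<in> \<C>'. v \<in> D})"
    proof (rule finite_subset)
      \<comment> \<open>Each connected \<open>D\<close> containing \<open>v\<close> has
        \<open>t D\<close> below \<open>v\<close> in \<open>T\<close>, and \<open>v\<close> has only
        finitely many predecessors.\<close>
      show "t ` {D \<in> \<C>'. v \<in> D} \<subseteq> {u. tree_le T u v}" using t(2) that T(2) by blast
      show "finite {u. tree_le T u v}"
        by (rule finite_tree_le) (use T(1) in \<open>simp add: weak_normal_tree_def\<close>)
    qed
  qed (use that in simp)
  then have "U \<inter> S' \<subseteq> verts tree" by (rule subsetI)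
  then show "\<exists>T'. normal_tree S' \<C>' T' \<and> U \<inter> S' \<subseteq> verts T'"
    using normal_tree by (intro exI[of _ tree] conjI)
qed

end
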